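(* Let $\bm{\eta}_p:[u_0,u_N]\to\mathbb{R}^3$ be a $C^1$ Pythagorean-hodograph quintic spline path, as described in the context. Let the fluid have constant irrotational current velocity $\dot{\bm{\eta}}_c\in\mathbb{R}^3$, and let the vehicle position $\bm{\eta}=\bm{\eta}(t)$ satisfy $$\dot{\bm{\eta}}=\dot{\bm{\eta}}_d-\dot{\hat{\bm{\eta}}}_c+\dot{\bm{\eta}}_c ,$$ where $\dot{\hat{\bm{\eta}}}_c=\dot{\hat{\bm{\eta}}}_c(t)$ is the estimated velocity of the current. If the desired velocity $\dot{\bm{\eta}}_d$ (together with the path parameter $u=u(t)$) is computed with the guidance law described in the context, and $$\ddot{\hat{\bm{\eta}}}_c=k_c\,(\bm{\eta}-\bm{\eta}_p),\qquad\text{with } k_c>0,$$ where $\ddot{\hat{\bm{\eta}}}_c$ is the time derivative of $\dot{\hat{\bm{\eta}}}_c$ and $\bm{\eta}_p$ is evaluated at $u(t)$, then $$\lim_{t\to\infty}\Vert\dot{\tilde{\bm{\eta}}}_c\Vert=0\qquad\text{and}\qquad\lim_{t\to\infty}\Vert\bm{\varepsilon}^p\Vert=0,$$ where $\dot{\tilde{\bm{\eta}}}_c:=\dot{\bm{\eta}}_c-\dot{\hat{\bm{\eta}}}_c$ is the estimation error and $\bm{\varepsilon}^p$ is the track error defined in the context.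
   Context: Notation. $\Vert\cdot\Vert$ is the Euclidean norm. Vectors of $\mathbb{R}^3$ are identified with pure quaternions; for a unit quaternion $\mathcal{Q}$ with conjugate $\mathcal{Q}^*$, the map $\bm{v}\mapsto\mathcal{Q}\,\bm{v}\,\mathcal{Q}^*$ is a rotation of $\mathbb{R}^3$. For angles $\chi,\nu$ put (scalar part first) $$\mathcal{Q}_z(\chi)=\left(\cos\tfrac{\chi}{2},0,0,\sin\tfrac{\chi}{2}\right)^\top,\qquad \mathcal{Q}_y(\nu)=\left(\cos\tfrac{\nu}{2},0,\sin\tfrac{\nu}{2},0\right)^\top,$$ the rotations by $\chi$ about the $z$-axis and by $\nu$ about the $y$-axis. For real $a,b$, $\mathrm{Arg}(a,b)\in(-\pi,\pi]$ is the four-quadrant angle $\theta$ of the planar vector $(a,b)$, i.e. $a=r\cos\theta$, $b=r\sin\theta$, $r=\sqrt{a^2+b^2}$, with $\mathrm{Arg}(0,0)=0$. Path. Let $u_0<u_1<\cdots<u_N$ be parameter values, $\bm{p}_0,\dots,\bm{p}_N$ points and $\bm{d}_0,\dots,\bm{d}_N$ tangent vectors in three-dimensional space. The path $\bm{\eta}_p=(x_p,y_p,z_p)^\top:[u_0,u_N]\to\mathbb{R}^3$ is a $C^1$ spline with $\bm{\eta}_p(u_k)=\bm{p}_k$ and $\bm{\eta}_p'(u_k)=\bm{d}_k$ for $k=0,\dots,N$, with $\bm{\eta}_p'(u)\ne\bm{0}$, and such that on each $[u_{k-1},u_k]$, $k=1,\dots,N$, it is a quintic Pythagorean-hodograph curve: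 $\bm{\eta}_p'(u)=\mathcal{A}_k(u)\,\bm{w}\,\mathcal{A}_k^*(u)$, where $\mathcal{A}_k$ is a quadratic quaternion polynomial and $\bm{w}$ is a fixed unit vector. Thus on each segment $\bm{\eta}_p$ is a polynomial curve of degree 5 and the parametric speed $\Vert\bm{\eta}_p'(u)\Vert=\mathcal{A}_k(u)\mathcal{A}_k^*(u)$ is a quartic polynomial. Path frame and track error. Define the azimuth and elevation angles $$\chi_p(u)=\mathrm{Arg}\bigl(x_p'(u),y_p'(u)\bigr),\qquad \nu_p(u)=\mathrm{Arg}\Bigl(\sqrt{x_p'(u)^2+y_p'(u)^2},\,-z_p'(u)\Bigr),$$ and $\mathcal{Q}_p=\mathcal{Q}_z(\chi_p)\mathcal{Q}_y(\nu_p)$, so that $\mathcal{Q}_p(1,0,0)^\top\mathcal{Q}_p^*=\bm{\eta}_p'/\Vert\bm{\eta}_p'\Vert$. The track error is $$\bm{\varepsilon}^p=(s,e,h)^\top:=\mathcal{Q}_p^*\,(\bm{\eta}-\bm{\eta}_p(u))\,\mathcal{Q}_p,$$ where $s,e,h$ are the along-track, cross-track and vertical-track errors. Guidance law. Let $\gamma,\mu,\Delta_e$ be positive parameters and let $U_d$ be the desired vehicle speed, $U_d=\Vert\dot{\bm{\eta}}_d\Vert$. The guidance law allows any positive $U_d$; in particular, $U_d$ may be chosen as $$U_d=\frac{U_0}{\mu\Delta_e}\sqrt{\mu^2(\Delta_e^2+e^2)+h^2}$$ with $U_0$ a given positive constant velocity value. Set $$\chi_r=\arctan\Bigl(-\frac{e}{\Delta_e}\Bigr),\qquad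 \nu_r=\arctan\Bigl(\frac{h}{\Delta_h}\Bigr),\qquad \Delta_h=\mu\sqrt{\Delta_e^2+e^2},$$ $$x_{num}=\cos\chi_p\sin\chi_r\cos\nu_r-\sin\chi_p\sin\nu_p\sin\nu_r+\sin\chi_p\cos\chi_r\cos\nu_p\cos\nu_r,$$ $$x_{den}=-\sin\chi_p\sin\chi_r\cos\nu_r-\cos\chi_p\sin\nu_p\sin\nu_r+\cos\chi_p\cos\chi_r\cos\nu_p\cos\nu_r,$$ $$\chi_d=\mathrm{Arg}(x_{den},x_{num}),\qquad \nu_d=\arcsin(\sin\nu_p\cos\chi_r\cos\nu_r+\cos\nu_p\sin\nu_r).$$ With $\mathcal{Q}_d=\mathcal{Q}_z(\chi_d)\mathcal{Q}_y(\nu_d)$, the desired velocity and the evolution of the path parameter are $$\dot{\bm{\eta}}_d=\mathcal{Q}_d\,(U_d,0,0)^\top\,\mathcal{Q}_d^*,\qquad \dot u=\frac{U_d\cos\chi_r\cos\nu_r+\gamma s}{\Vert\bm{\eta}_p'(u)\Vert}.$$ Here $\dot{\bm{\eta}}_d$ denotes the vector given by this formula, evaluated at each time from $\bm{\eta}(t)$ and $u(t)$.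
   Formalization: "Any positive U_d" is false (e.g. U_d decaying exponentially in time); here U_d is positive and, for each R, lies between two positive constants at times when the track error is at most R. The path may also be continued regularly beyond [u_0,u_N]. *)

theory Defs
  imports "HOL-Analysis.Analysis"
begin

section \<open>Quaternions\<close>

text \<open>A quaternion is a pair of its scalar part and its vector part; addition and scaling by reals
  are those of the product space.\<close>

type_synonym quat = "real \<times> (real ^ 3)"

definition qmul :: "quat \<Rightarrow> quat \<Rightarrow> quat" where
  "qmul p q = (fst p * fst q - snd p \<bullet> snd q,
               fst p *\<^sub>R snd q + fst q *\<^sub>R snd p + cross3 (snd p) (snd q))"

definition qconj :: "quat \<Rightarrow> quat" where
  "qconj q = (fst q, - snd q)"

definition pure :: "real ^ 3 \<Rightarrow> quat" where
  "pure v = (0, v)"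

definition rotate_by :: "quat \<Rightarrow> real ^ 3 \<Rightarrow> real ^ 3" where
  "rotate_by q v = snd (qmul (qmul q (pure v)) (qconj q))"

definition Qz :: "real \<Rightarrow> quat" where
  "Qz \<theta> = (cos (\<theta> / 2), vector [0, 0, sin (\<theta> / 2)])"

definition Qy :: "real \<Rightarrow> quat" where
  "Qy \<nu> = (cos (\<nu> / 2), vector [0, sin (\<nu> / 2), 0])"


section \<open>Paths\<close>

text \<open>A spline lives on the compact interval of its knots. There, a positive speed bounded away from
  zero drives the path parameter out at the last knot in finite time, so that no motion for all times
  would exist. Hence a path may also be given on a larger parameter interval \<open>I\<close>, where it is only
  required to be regular and \<open>C\<^sup>1\<close>, for instance by further segments, by periodicity or along
  the end tangents. The case of no continuation is that \<open>I\<close> is the interval of the knots.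

  Throughout, \<open>\<eta>p'\<close> is the derivative of \<open>\<eta>p\<close>, one-sided at end points of the interval.\<close>

definition regular_C1_path :: "real set \<Rightarrow> (real \<Rightarrow> real ^ 3) \<Rightarrow> (real \<Rightarrow> real ^ 3) \<Rightarrow> bool" where
  "regular_C1_path I \<eta>p \<eta>p' \<longleftrightarrow>
     is_interval I \<and>
     (\<forall>v\<in>I. (\<eta>p has_vector_derivative \<eta>p' v) (at v within I)) \<and>
     continuous_on I \<eta>p' \<and>
     (\<forall>v\<in>I. \<eta>p' v \<noteq> 0)"

text \<open>A quadratic quaternion polynomial is one of degree at most two, so that quintic includes
  curves of lower degree such as straight lines.\<close>

definition ph_quintic_on :: "real set \<Rightarrow> real ^ 3 \<Rightarrow> (real \<Rightarrow> real ^ 3) \<Rightarrow> bool" where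
  "ph_quintic_on J w \<eta>p' \<longleftrightarrow>
     (\<exists>a b c :: quat. \<forall>v\<in>J.
        let A = a + v *\<^sub>R b + v\<^sup>2 *\<^sub>R c
        in pure (\<eta>p' v) = qmul (qmul A (pure w)) (qconj A))"

definition ph_quintic_spline ::
  "nat \<Rightarrow> (nat \<Rightarrow> real) \<Rightarrow> (nat \<Rightarrow> real ^ 3) \<Rightarrow> (nat \<Rightarrow> real ^ 3) \<Rightarrow> real ^ 3
     \<Rightarrow> (real \<Rightarrow> real ^ 3) \<Rightarrow> (real \<Rightarrow> real ^ 3) \<Rightarrow> bool" where
  "ph_quintic_spline N knot p d w \<eta>p \<eta>p' \<longleftrightarrow>
     1 \<le> N \<and>
     (\<forall>k\<in>{1..N}. knot (k - 1) < knot k) \<and>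
     norm w = 1 \<and>
     regular_C1_path {knot 0..knot N} \<eta>p \<eta>p' \<and>
     (\<forall>k\<le>N. \<eta>p (knot k) = p k \<and> \<eta>p' (knot k) = d k) \<and>
     (\<forall>k\<in>{1..N}. ph_quintic_on {knot (k - 1)..knot k} w \<eta>p')"


section \<open>Path frame and track error\<close>

text \<open>Here \<open>\<tau>\<close> is the path derivative at the current parameter. The four-quadrant angle of
  \<open>(a, b)\<close> is the library's argument of \<open>a + b\<i>\<close>, which is \<open>0\<close> at the origin.\<close>

definition path_azimuth :: "real ^ 3 \<Rightarrow> real" where
  "path_azimuth \<tau> = Arg (Complex (\<tau> $ 1) (\<tau> $ 2))"

definition path_elevation :: "real ^ 3 \<Rightarrow> real" where
  "path_elevation \<tau> = Arg (Complex (sqrt ((\<tau> $ 1)\<^sup>2 + (\<tau> $ 2)\<^sup>2)) (- (\<tau> $ 3)))"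

definition path_frame :: "real ^ 3 \<Rightarrow> quat" where
  "path_frame \<tau> = qmul (Qz (path_azimuth \<tau>)) (Qy (path_elevation \<tau>))"

text \<open>The components of the track error are the along-track error \<open>s\<close>, the cross-track error \<open>e\<close>
  and the vertical-track error \<open>h\<close>, in this order.\<close>

definition track_error :: "real ^ 3 \<Rightarrow> real ^ 3 \<Rightarrow> real ^ 3" where
  "track_error \<tau> x = rotate_by (qconj (path_frame \<tau>)) x"


section \<open>Guidance law\<close>

definition chi_r :: "real \<Rightarrow> real ^ 3 \<Rightarrow> real" where
  "chi_r \<Delta>e \<epsilon> = arctan (- (\<epsilon> $ 2 / \<Delta>e))"

definition Delta_h :: "real \<Rightarrow> real \<Rightarrow> real ^ 3 \<Rightarrow> real" where
  "Delta_h \<mu> \<Delta>e \<epsilon> = \<mu> * sqrt (\<Delta>e\<^sup>2 + (\<epsilon> $ 2)\<^sup>2)"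

definition nu_r :: "real \<Rightarrow> real \<Rightarrow> real ^ 3 \<Rightarrow> real" where
  "nu_r \<mu> \<Delta>e \<epsilon> = arctan (\<epsilon> $ 3 / Delta_h \<mu> \<Delta>e \<epsilon>)"

definition chi_d :: "real \<Rightarrow> real \<Rightarrow> real ^ 3 \<Rightarrow> real ^ 3 \<Rightarrow> real" where
  "chi_d \<mu> \<Delta>e \<tau> \<epsilon> =
     (let chip = path_azimuth \<tau>; nup = path_elevation \<tau>; chir = chi_r \<Delta>e \<epsilon>; nur = nu_r \<mu> \<Delta>e \<epsilon>;
          xnum = cos chip * sin chir * cos nur - sin chip * sin nup * sin nur
                   + sin chip * cos chir * cos nup * cos nur;
          xden = - sin chip * sin chir * cos nur - cos chip * sin nup * sin nur
                   + cos chip * cos chir * cos nup * cos nur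
      in Arg (Complex xden xnum))"

definition nu_d :: "real \<Rightarrow> real \<Rightarrow> real ^ 3 \<Rightarrow> real ^ 3 \<Rightarrow> real" where
  "nu_d \<mu> \<Delta>e \<tau> \<epsilon> =
     (let nup = path_elevation \<tau>; chir = chi_r \<Delta>e \<epsilon>; nur = nu_r \<mu> \<Delta>e \<epsilon>
      in arcsin (sin nup * cos chir * cos nur + cos nup * sin nur))"

definition desired_velocity :: "real \<Rightarrow> real \<Rightarrow> real \<Rightarrow> real ^ 3 \<Rightarrow> real ^ 3 \<Rightarrow> real ^ 3" where
  "desired_velocity Ud \<mu> \<Delta>e \<tau> \<epsilon> =
     rotate_by (qmul (Qz (chi_d \<mu> \<Delta>e \<tau> \<epsilon>)) (Qy (nu_d \<mu> \<Delta>e \<tau> \<epsilon>))) (vector [Ud, 0, 0])"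

definition parameter_rate :: "real \<Rightarrow> real \<Rightarrow> real \<Rightarrow> real \<Rightarrow> real ^ 3 \<Rightarrow> real ^ 3 \<Rightarrow> real" where
  "parameter_rate Ud \<gamma> \<mu> \<Delta>e \<tau> \<epsilon> =
     (Ud * cos (chi_r \<Delta>e \<epsilon>) * cos (nu_r \<mu> \<Delta>e \<epsilon>) + \<gamma> * \<epsilon> $ 1) / norm \<tau>"


section \<open>Desired speed\<close>

text \<open>The desired speed is a positive signal along the motion. Positivity alone does not suffice: if the
  speed decays fast enough, the errors need not converge, and if it grows without bound, the current
  estimate need not converge. So the speed has to lie between two positive constants on the times
  at which the track error is at most \<open>R\<close>, for each \<open>R\<close>. The lemmas below show that this covers
  constant speeds, the particular speed built from \<open>U0\<close>, and, over a compact parameter range, every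
  speed that is a continuous positive function of the position and the path parameter.\<close>

definition admissible_speed :: "(real \<Rightarrow> real) \<Rightarrow> (real \<Rightarrow> real ^ 3) \<Rightarrow> bool" where
  "admissible_speed Ud \<epsilon> \<longleftrightarrow>
     (\<forall>t\<ge>0. 0 < Ud t) \<and>
     (\<forall>R. \<exists>a>0. \<exists>b. \<forall>t\<ge>0. norm (\<epsilon> t) \<le> R \<longrightarrow> a \<le> Ud t \<and> Ud t \<le> b)"

lemma admissible_speed_const:
  assumes "0 < U0"
  shows "admissible_speed (\<lambda>t. U0) \<epsilon>"
  using assms by (auto simp: admissible_speed_def)

lemma admissible_speed_particular:
  assumes U0: "0 < U0" and mu: "0 < \<mu>" and De: "0 < \<Delta>e"
  shows "admissible_speed
           (\<lambda>t. U0 / (\<mu> * \<Delta>e) * sqrt (\<mu>\<^sup>2 * (\<Delta>e\<^sup>2 + (\<epsilon> t $ 2)\<^sup>2) + (\<epsilon> t $ 3)\<^sup>2)) \<epsilon>"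
    (is "admissible_speed ?U \<epsilon>")
proof -
  have low: "U0 \<le> ?U t" for t
  proof -
    have "(\<mu> * \<Delta>e)\<^sup>2 \<le> \<mu>\<^sup>2 * (\<Delta>e\<^sup>2 + (\<epsilon> t $ 2)\<^sup>2) + (\<epsilon> t $ 3)\<^sup>2"
      by (simp add: algebra_simps)
    then have "\<mu> * \<Delta>e \<le> sqrt (\<mu>\<^sup>2 * (\<Delta>e\<^sup>2 + (\<epsilon> t $ 2)\<^sup>2) + (\<epsilon> t $ 3)\<^sup>2)"
      by (rule real_le_rsqrt)
    then have "U0 / (\<mu> * \<Delta>e) * (\<mu> * \<Delta>e) \<le> ?U t"
      using assms by (intro mult_left_mono) auto
    then show ?thesis using mu De by simp
  qed
  have up: "?U t \<le> U0 / (\<mu> * \<Delta>e) * sqrt (\<mu>\<^sup>2 * (\<Delta>e\<^sup>2 + R\<^sup>2) + R\<^sup>2)" if "norm (\<epsilon> t) \<le> R" for t R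
  proof -
    have "(\<epsilon> t $ i)\<^sup>2 \<le> R\<^sup>2" for i
      using component_le_norm_cart[of "\<epsilon> t" i] that by (simp add: abs_le_square_iff[symmetric])
    then have "\<mu>\<^sup>2 * (\<Delta>e\<^sup>2 + (\<epsilon> t $ 2)\<^sup>2) + (\<epsilon> t $ 3)\<^sup>2 \<le> \<mu>\<^sup>2 * (\<Delta>e\<^sup>2 + R\<^sup>2) + R\<^sup>2"
      by (intro add_mono mult_left_mono) auto
    then show ?thesis using assms by (intro mult_left_mono) auto
  qed
  show ?thesis
    unfolding admissible_speed_def using low up U0 by (meson less_le_trans)
qed

lemma qmul_norm: "norm (qmul p q) = norm p * norm q"
proof -
  have "(norm (qmul p q))\<^sup>2 = (norm p)\<^sup>2 * (norm q)\<^sup>2"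
    by (cases p; cases q)
      (simp add: qmul_def norm_Pair power2_norm_eq_inner inner_vec_def sum_3 cross3_def,
       simp add: algebra_simps power2_eq_square)
  then show ?thesis
    by (simp flip: power_mult_distrib)
qed

lemma qconj_norm: "norm (qconj q) = norm q"
  by (cases q) (simp add: qconj_def norm_Pair)

lemma rotate_by_norm: "norm (rotate_by q v) = (norm q)\<^sup>2 * norm v"
proof -
  have "fst (qmul (qmul q (pure v)) (qconj q)) = 0"
    by (cases q)
      (simp add: qmul_def qconj_def pure_def inner_vec_def sum_3 cross3_def algebra_simps)
  then have "norm (rotate_by q v) = norm (qmul (qmul q (pure v)) (qconj q))"
    by (simp add: rotate_by_def norm_prod_def)
  then show ?thesis
    by (simp add: qmul_norm qconj_norm pure_def norm_Pair power2_eq_square)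
qed

lemma path_frame_norm: "norm (path_frame \<tau>) = 1"
  by (simp add: path_frame_def qmul_norm Qz_def Qy_def norm_Pair power2_norm_eq_inner
      inner_vec_def sum_3 flip: power2_eq_square)

lemma track_error_norm: "norm (track_error \<tau> x) = norm x"
  by (simp add: track_error_def rotate_by_norm qconj_norm path_frame_norm)

lemma admissible_speed_continuous_feedback:
  fixes f :: "(real ^ 3) \<times> real \<Rightarrow> real"
  assumes f: "continuous_on (UNIV \<times> I) f" and pos: "\<And>x v. v \<in> I \<Longrightarrow> 0 < f (x, v)"
    and I: "compact I" and eta_p: "continuous_on I \<eta>p"
    and u: "\<And>t. 0 \<le> t \<Longrightarrow> u t \<in> I"
  shows "admissible_speed (\<lambda>t. f (\<eta> t, u t)) (\<lambda>t. track_error (\<tau> t) (\<eta> t - \<eta>p (u t)))"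
proof -
  have "\<exists>a>0. \<exists>b. \<forall>t\<ge>0. norm (\<eta> t - \<eta>p (u t)) \<le> R \<longrightarrow> a \<le> f (\<eta> t, u t) \<and> f (\<eta> t, u t) \<le> b" for R
  proof (cases "\<exists>t\<ge>0. norm (\<eta> t - \<eta>p (u t)) \<le> R")
    case True
    define K where "K = (\<lambda>(y, v). (\<eta>p v + y, v)) ` (cball 0 R \<times> I)"
    have "compact K"
      unfolding K_def case_prod_unfold
      by (intro compact_continuous_image compact_Times compact_cball I continuous_intros
          continuous_on_compose2[OF eta_p]) auto
    moreover have inK: "(\<eta> t, u t) \<in> K" if "0 \<le> t" "norm (\<eta> t - \<eta>p (u t)) \<le> R" for t
      unfolding K_def using that u by (intro image_eqI[of _ _ "(\<eta> t - \<eta>p (u t), u t)"]) auto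
    moreover have "K \<noteq> {}" using True inK by auto
    moreover have sub: "K \<subseteq> UNIV \<times> I" by (auto simp: K_def)
    moreover have "continuous_on K f" by (rule continuous_on_subset[OF f sub])
    ultimately obtain z y where "z \<in> K" and z: "\<And>x. x \<in> K \<Longrightarrow> f z \<le> f x"
      and y: "\<And>x. x \<in> K \<Longrightarrow> f x \<le> f y"
      using continuous_attains_inf[of K f] continuous_attains_sup[of K f] by metis
    have "0 < f z" using \<open>z \<in> K\<close> sub pos by (cases z) auto
    then show ?thesis using z y inK by blast
  next
    case False
    then show ?thesis by (intro exI[of _ 1]) auto
  qed
  then show ?thesis
    using pos u by (auto simp: admissible_speed_def track_error_norm)
qed

end

theory Submission
  imports Defs
begin

text \<open>Let \<open>\<xi>\<close> be the position error \<open>\<eta> - \<eta>\<^sub>p(u)\<close> and \<open>z\<close> the error of the current estimate. The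
  parameter rate cancels the tangential part of the desired velocity, so that \<open>\<xi>' = g + z\<close>, where
  in the path frame \<open>g\<close> is \<open>(- \<gamma> s, - U\<^sub>d \<mu> e / D, - U\<^sub>d h / D)\<close> with
  \<open>D\<^sup>2 = \<mu>\<^sup>2 (\<Delta>\<^sub>e\<^sup>2 + e\<^sup>2) + h\<^sup>2\<close>, and \<open>z' = - k\<^sub>c \<xi>\<close>. The function \<open>|\<xi>|\<^sup>2 + |z|\<^sup>2 / k\<^sub>c\<close> does not increase;
  hence \<open>\<xi>\<close> stays in a ball, on which \<open>\<xi> \<bullet> g \<le> - k |\<xi>|\<^sup>2\<close> and \<open>|g| \<le> C |\<xi>|\<close> for constants \<open>k > 0\<close>
  and \<open>C\<close>. Subtracting \<open>2 \<delta> (\<xi> \<bullet> z)\<close> for a small \<open>\<delta> > 0\<close> makes it a strict Lyapunov function, and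
  both errors decay exponentially. The path frame is never differentiated; it may jump where the
  path tangent is vertical.\<close>

section \<open>Scalar differential inequalities\<close>

lemma has_real_derivative_nonpos_imp_le:
  fixes f f' :: "real \<Rightarrow> real"
  assumes "\<And>t. 0 \<le> t \<Longrightarrow> (f has_real_derivative f' t) (at t within {0..})"
    and "\<And>t. 0 \<le> t \<Longrightarrow> f' t \<le> 0" and "0 \<le> t"
  shows "f t \<le> f 0"
proof -
  have "(f has_derivative (\<lambda>h. f' x * h)) (at x within {0..t})" if "0 \<le> x" "x \<le> t" for x
    using has_field_derivative_subset[OF assms(1), of x "{0..t}"] that
    by (simp add: has_field_derivative_def)
  from mvt_very_simple[OF \<open>0 \<le> t\<close> this] obtain x where "x \<in> {0..t}" "f t - f 0 = f' x * (t - 0)"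
    by auto
  moreover have "f' x * (t - 0) \<le> 0"
    using assms(2)[of x] \<open>0 \<le> t\<close> calculation(1) by (simp add: mult_nonpos_nonneg)
  ultimately show ?thesis by simp
qed

text \<open>The integrating factor \<open>exp (l * t)\<close> turns the inequality into monotonicity
  of a product.\<close>

lemma exponential_decay:
  fixes W W' :: "real \<Rightarrow> real"
  assumes deriv: "\<And>t. 0 \<le> t \<Longrightarrow> (W has_real_derivative W' t) (at t within {0..})"
    and le: "\<And>t. 0 \<le> t \<Longrightarrow> W' t \<le> - l * W t" and "0 \<le> t"
  shows "W t \<le> W 0 * exp (- l * t)"
proof -
  have "exp (l * t) * W t \<le> exp (l * 0) * W 0"
  proof (rule has_real_derivative_nonpos_imp_le[where f = "\<lambda>t. exp (l * t) * W t"
        and f' = "\<lambda>t. exp (l * t) * (l * W t + W' t)"])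
    show "((\<lambda>t. exp (l * t) * W t) has_real_derivative exp (l * t) * (l * W t + W' t))
        (at t within {0..})" if "0 \<le> t" for t
      by (rule derivative_eq_intros deriv[OF that] refl)+ (simp add: algebra_simps)
    show "exp (l * t) * (l * W t + W' t) \<le> 0" if "0 \<le> t" for t
      using le[OF that] by (simp add: mult_nonneg_nonpos)
  qed (use \<open>0 \<le> t\<close> in auto)
  then show ?thesis by (simp add: exp_minus field_simps)
qed

section \<open>Lyapunov analysis of the coupled position and current errors\<close>

lemma has_real_derivative_inner:
  fixes f g :: "real \<Rightarrow> 'a :: real_inner"
  assumes "(f has_vector_derivative f') (at t within S)" "(g has_vector_derivative g') (at t within S)"
  shows "((\<lambda>t. f t \<bullet> g t) has_real_derivative f t \<bullet> g' + f' \<bullet> g t) (at t within S)"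
  using bounded_bilinear.has_vector_derivative[OF bounded_bilinear_inner assms]
  by (simp add: has_real_derivative_iff_has_vector_derivative)

text \<open>The field \<open>g\<close> enters only through pointwise bounds along the motion, so it
  may be discontinuous in time, as it is where the path frame jumps. Its constants may depend on the
  radius \<open>R\<close>; a first, non-strict Lyapunov function confines the motion to one ball and
  thereby fixes them.\<close>

lemma observer_error_convergence:
  fixes \<xi> z g :: "real \<Rightarrow> 'a :: real_inner"
  assumes kc: "0 < kc"
    and \<xi>: "\<And>t. 0 \<le> t \<Longrightarrow> (\<xi> has_vector_derivative g t + z t) (at t within {0..})"
    and z: "\<And>t. 0 \<le> t \<Longrightarrow> (z has_vector_derivative - kc *\<^sub>R \<xi> t) (at t within {0..})"
    and g: "\<And>R. \<exists>k>0. \<exists>C. \<forall>t\<ge>0. norm (\<xi> t) \<le> R \<longrightarrow>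
              \<xi> t \<bullet> g t \<le> - k * (norm (\<xi> t))\<^sup>2 \<and> norm (g t) \<le> C * norm (\<xi> t)"
  shows "((\<lambda>t. norm (\<xi> t)) \<longlongrightarrow> 0) at_top" "((\<lambda>t. norm (z t)) \<longlongrightarrow> 0) at_top"
proof -
  define V where "V = (\<lambda>t. \<xi> t \<bullet> \<xi> t + z t \<bullet> z t / kc)"
  \<comment> \<open>The weight \<open>1 / kc\<close> makes the two coupling terms in
    \<open>\<xi> t \<bullet> z t\<close> cancel, leaving only the contribution of
    \<open>g\<close>.\<close>
  have dV: "(V has_real_derivative 2 * (\<xi> t \<bullet> g t)) (at t within {0..})" if "0 \<le> t" for t
    unfolding V_def
    by (rule DERIV_cong[OF DERIV_add[OF has_real_derivative_inner[OF \<xi> \<xi>]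
            DERIV_cdivide[OF has_real_derivative_inner[OF z z]]]]; (rule that)?)
      (use kc in \<open>simp add: inner_add_left inner_add_right inner_commute[of "g t"] inner_commute[of "z t"]\<close>)
  have "\<xi> t \<bullet> g t \<le> 0" if t: "0 \<le> t" for t
  proof -
    obtain k where "0 < k" "\<xi> t \<bullet> g t \<le> - k * (norm (\<xi> t))\<^sup>2"
      using g[of "norm (\<xi> t)"] t by blast
    moreover have "0 \<le> k * (norm (\<xi> t))\<^sup>2" using \<open>0 < k\<close> by simp
    ultimately show ?thesis by linarith
  qed
  then have V0: "V t \<le> V 0" if "0 \<le> t" for t
    using has_real_derivative_nonpos_imp_le[of V "\<lambda>t. 2 * (\<xi> t \<bullet> g t)" t] dV that by simp
  have bound: "norm (\<xi> t) \<le> sqrt (V 0)" if "0 \<le> t" for t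
  proof -
    have "(norm (\<xi> t))\<^sup>2 \<le> V t" using kc by (simp add: V_def power2_norm_eq_inner)
    then show ?thesis using V0[OF that] by (simp add: real_le_rsqrt)
  qed
  \<comment> \<open>With \<open>R = sqrt (V 0)\<close> the bounds hold at all times t \<ge> 0 with
    the same constants.\<close>
  obtain k C where k: "0 < k"
    and g1: "\<And>t. 0 \<le> t \<Longrightarrow> \<xi> t \<bullet> g t \<le> - k * (norm (\<xi> t))\<^sup>2"
    and g2: "\<And>t. 0 \<le> t \<Longrightarrow> norm (g t) \<le> C * norm (\<xi> t)"
    using g[of "sqrt (V 0)"] bound by blast

  \<comment> \<open>The first two bounds keep \<open>W\<close> comparable to the squared errors
    \<open>S\<close>; the third lets half of the dissipation \<open>2 * k\<close> absorb the terms
    in \<open>\<xi>\<close> that the cross term produces.\<close>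
  define \<delta> where "\<delta> = min (min (1 / 2) (1 / (2 * kc))) (k / (2 * kc + C\<^sup>2))"
  have den: "0 < 2 * kc + C\<^sup>2" using kc by (simp add: add_pos_nonneg)
  have "0 < \<delta>" using kc k den by (simp add: \<delta>_def)
  moreover have "\<delta> \<le> 1 / 2" "\<delta> \<le> 1 / (2 * kc)" "\<delta> \<le> k / (2 * kc + C\<^sup>2)"
    unfolding \<delta>_def by linarith+
  ultimately have \<delta>: "0 < \<delta>" "\<delta> \<le> 1 / 2" "\<delta> \<le> 1 / (2 * kc)" "\<delta> \<le> k / (2 * kc + C\<^sup>2)"
    by auto
  then have \<delta>k: "\<delta> * (2 * kc + C\<^sup>2) \<le> k" using den by (simp add: field_simps)
  define S where "S = (\<lambda>t. (norm (\<xi> t))\<^sup>2 + (norm (z t))\<^sup>2)"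
  define W where "W = (\<lambda>t. V t - 2 * \<delta> * (\<xi> t \<bullet> z t))"
  define m where "m = min (1 / 2) (1 / (2 * kc))"
  define K where "K = 1 + 1 / kc + \<delta>"
  have m: "0 < m" and K: "0 < K" using kc \<delta> by (auto simp: m_def K_def add_pos_pos)
  have m_le: "m \<le> 1 / 2" "m \<le> 1 / (2 * kc)" unfolding m_def by linarith+
  have cross: "\<bar>2 * (x \<bullet> y)\<bar> \<le> (norm x)\<^sup>2 + (norm y)\<^sup>2" for x y :: 'a
    using Cauchy_Schwarz_ineq2[of x y] sum_squares_bound[of "norm x" "norm y"] by linarith
  have cross\<delta>: "\<bar>2 * \<delta> * (\<xi> t \<bullet> z t)\<bar> \<le> \<delta> * S t" for t
    using mult_left_mono[OF cross[of "\<xi> t" "z t"], of \<delta>] \<delta>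
    by (simp add: S_def abs_mult algebra_simps)
  have V_S: "V t = (norm (\<xi> t))\<^sup>2 + 1 / kc * (norm (z t))\<^sup>2" for t
    by (simp add: V_def power2_norm_eq_inner)
  have low: "m * S t \<le> W t" for t
  proof -
    have "(m + \<delta>) * (norm (\<xi> t))\<^sup>2 \<le> 1 * (norm (\<xi> t))\<^sup>2"
      using \<delta>(2) m_le(1) by (intro mult_right_mono) auto
    moreover have "(m + \<delta>) * (norm (z t))\<^sup>2 \<le> 1 / kc * (norm (z t))\<^sup>2"
    proof (intro mult_right_mono)
      show "m + \<delta> \<le> 1 / kc" using \<delta>(3) m_le(2) by (simp add: field_simps)
    qed auto
    ultimately show ?thesis
      using cross\<delta>[of t] unfolding W_def V_S S_def by (simp add: algebra_simps)
  qed
  have up: "W t \<le> K * S t" for t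
  proof -
    have "V t \<le> (1 + 1 / kc) * S t"
      using kc by (simp add: V_S S_def algebra_simps)
    then show ?thesis
      using cross\<delta>[of t] unfolding W_def K_def by (simp add: algebra_simps)
  qed
  \<comment> \<open>Differentiating the cross term yields
    \<open>- 2 * \<delta> * (norm (z t))\<^sup>2\<close>, the dissipation in \<open>z\<close> that
    \<open>V\<close> lacks.\<close>
  define W' where "W' = (\<lambda>t. 2 * (\<xi> t \<bullet> g t)
      - 2 * \<delta> * ((norm (z t))\<^sup>2 + g t \<bullet> z t - kc * (norm (\<xi> t))\<^sup>2))"
  have dW: "(W has_real_derivative W' t) (at t within {0..})" if "0 \<le> t" for t
    unfolding W_def
    by (rule DERIV_cong[OF DERIV_diff[OF dV DERIV_cmult[OF has_real_derivative_inner[OF \<xi> z]]]];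
        (rule that)?)
      (simp add: W'_def inner_simps power2_norm_eq_inner algebra_simps)
  define l where "l = min k \<delta>"
  have l: "0 < l" using k \<delta> by (simp add: l_def)
  have "W' t \<le> - (l / K) * W t" if "0 \<le> t" for t
  proof -
    have "(norm (g t))\<^sup>2 \<le> C\<^sup>2 * (norm (\<xi> t))\<^sup>2"
      using power_mono[OF g2[OF that], of 2] by (simp add: power_mult_distrib)
    \<comment> \<open>Young's inequality: the \<open>z\<close> part costs only half of the new
      dissipation, and the \<open>g\<close> part is controlled by \<open>\<xi>\<close>.\<close>
    then have "- (2 * (g t \<bullet> z t)) \<le> C\<^sup>2 * (norm (\<xi> t))\<^sup>2 + (norm (z t))\<^sup>2"
      using cross[of "g t" "z t"] by linarith
    then have "\<delta> * - (2 * (g t \<bullet> z t)) \<le> \<delta> * (C\<^sup>2 * (norm (\<xi> t))\<^sup>2 + (norm (z t))\<^sup>2)"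
      using \<delta> by (intro mult_left_mono) auto
    moreover have "\<delta> * (2 * kc + C\<^sup>2) * (norm (\<xi> t))\<^sup>2 \<le> k * (norm (\<xi> t))\<^sup>2"
      using \<delta>k by (intro mult_right_mono) auto
    ultimately have "W' t \<le> - k * (norm (\<xi> t))\<^sup>2 - \<delta> * (norm (z t))\<^sup>2"
      using g1[OF that] unfolding W'_def by (simp add: algebra_simps)
    moreover have "l * (norm (\<xi> t))\<^sup>2 \<le> k * (norm (\<xi> t))\<^sup>2" "l * (norm (z t))\<^sup>2 \<le> \<delta> * (norm (z t))\<^sup>2"
      by (auto simp: l_def intro!: mult_right_mono)
    ultimately have "W' t \<le> - (l * S t)" by (simp add: S_def algebra_simps)
    moreover have "(l / K) * W t \<le> (l / K) * (K * S t)"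
      using up[of t] l K by (intro mult_left_mono) auto
    ultimately show ?thesis using K by simp
  qed
  then have decay: "W t \<le> W 0 * exp (- (l / K) * t)" if "0 \<le> t" for t
    using exponential_decay[OF dW] that by blast
  have S_le: "S t \<le> W 0 / m * exp (- (l / K) * t)" if "0 \<le> t" for t
    using low[of t] decay[OF that] m by (simp add: field_simps)
  have "0 < l / K" using l K by simp
  then have "filterlim (\<lambda>t. - (l / K) * t) at_bot at_top"
    by (intro filterlim_tendsto_neg_mult_at_bot[OF tendsto_const] filterlim_ident) auto
  then have "((\<lambda>t. W 0 / m * exp (- (l / K) * t)) \<longlongrightarrow> W 0 / m * 0) at_top"
    by (intro tendsto_mult_left filterlim_compose[OF exp_at_bot])
  then have lim: "((\<lambda>t. sqrt (W 0 / m * exp (- (l / K) * t))) \<longlongrightarrow> 0) at_top"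
    using tendsto_real_sqrt by fastforce
  have "norm (\<xi> t) \<le> sqrt (S t)" "norm (z t) \<le> sqrt (S t)" for t
    by (auto intro!: real_le_rsqrt simp: S_def)
  then have "norm (\<xi> t) \<le> sqrt (W 0 / m * exp (- (l / K) * t))"
    "norm (z t) \<le> sqrt (W 0 / m * exp (- (l / K) * t))" if "0 \<le> t" for t
    using real_sqrt_le_mono[OF S_le[OF that]] order_trans by blast+
  then show "((\<lambda>t. norm (\<xi> t)) \<longlongrightarrow> 0) at_top" "((\<lambda>t. norm (z t)) \<longlongrightarrow> 0) at_top"
    by (auto intro!: tendsto_sandwich[OF _ _ tendsto_const lim] eventually_at_top_linorderI[of 0])
qed

section \<open>Quaternion rotations and spherical coordinates\<close>

lemma rotate_by_qmul: "rotate_by (qmul q r) v = rotate_by q (rotate_by r v)"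
  by (cases q; cases r)
    (simp add: rotate_by_def qmul_def qconj_def pure_def vec_eq_iff forall_3 inner_vec_def sum_3
      cross3_def algebra_simps)

text \<open>Conjugating the quaternion gives the adjoint map; this moves inner products between
  fixed and path coordinates.\<close>

lemma inner_rotate_by_qconj: "rotate_by (qconj q) x \<bullet> y = x \<bullet> rotate_by q y"
  by (cases q)
    (simp add: rotate_by_def qmul_def qconj_def pure_def inner_vec_def sum_3
      cross3_def algebra_simps)

lemma rotate_by_linear: "linear (rotate_by q)"
  by (cases q, rule linearI)
    (simp_all add: rotate_by_def qmul_def qconj_def pure_def vec_eq_iff forall_3 inner_vec_def sum_3
      cross3_def algebra_simps)

lemma rotate_by_Qz:
  "rotate_by (Qz \<theta>) v = vector [cos \<theta> * v $ 1 - sin \<theta> * v $ 2, sin \<theta> * v $ 1 + cos \<theta> * v $ 2, v $ 3]"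
proof -
  define a b where "a = cos (\<theta> / 2)" and "b = sin (\<theta> / 2)"
  \<comment> \<open>The third equation puts the factor cos^2 + sin^2 = 1 on the component along the
    axis, so that both sides become the same polynomial in the half-angle values \<open>a\<close>
    and \<open>b\<close>.\<close>
  have *: "cos \<theta> = a * a - b * b" "sin \<theta> = 2 * b * a" "v $ 3 = (a * a + b * b) * v $ 3"
    using cos_double[of "\<theta> / 2"] sin_double[of "\<theta> / 2"] sin_cos_squared_add3[of "\<theta> / 2"]
    by (simp_all add: a_def b_def power2_eq_square)
  show ?thesis
    unfolding rotate_by_def Qz_def a_def[symmetric] b_def[symmetric] *(1,2)
    by (subst *(3)) (simp add: qmul_def qconj_def pure_def vec_eq_iff forall_3 inner_vec_def sum_3
      cross3_def algebra_simps)
qed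

lemma rotate_by_Qy:
  "rotate_by (Qy \<theta>) v = vector [cos \<theta> * v $ 1 + sin \<theta> * v $ 3, v $ 2, cos \<theta> * v $ 3 - sin \<theta> * v $ 1]"
proof -
  define a b where "a = cos (\<theta> / 2)" and "b = sin (\<theta> / 2)"
  have *: "cos \<theta> = a * a - b * b" "sin \<theta> = 2 * b * a" "v $ 2 = (a * a + b * b) * v $ 2"
    using cos_double[of "\<theta> / 2"] sin_double[of "\<theta> / 2"] sin_cos_squared_add3[of "\<theta> / 2"]
    by (simp_all add: a_def b_def power2_eq_square)
  show ?thesis
    unfolding rotate_by_def Qy_def a_def[symmetric] b_def[symmetric] *(1,2)
    by (subst *(3)) (simp add: qmul_def qconj_def pure_def vec_eq_iff forall_3 inner_vec_def sum_3
      cross3_def algebra_simps)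
qed

text \<open>The form without division remains valid at \<open>z = 0\<close>, which is needed for
  vertical directions.\<close>

lemma cmod_times_cos_Arg: "cmod z * cos (Arg z) = Re z"
  and cmod_times_sin_Arg: "cmod z * sin (Arg z) = Im z"
  by (metis Re_rcis rcis_cmod_Arg, metis Im_rcis rcis_cmod_Arg)

lemma norm_Qz: "norm (Qz \<theta>) = 1" and norm_Qy: "norm (Qy \<theta>) = 1"
  by (simp_all add: Qz_def Qy_def norm_Pair power2_norm_eq_inner inner_vec_def sum_3
      flip: power2_eq_square)

text \<open>Spherical coordinates with elevation counted positive towards negative \<open>z\<close>,
  whence the sign in \<open>path_elevation\<close>.\<close>

lemma rotate_by_frame_axis1:
  "rotate_by (qmul (Qz \<alpha>) (Qy \<beta>)) (vector [r, 0, 0])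
     = vector [r * (cos \<alpha> * cos \<beta>), r * (sin \<alpha> * cos \<beta>), - (r * sin \<beta>)]"
  by (simp add: rotate_by_qmul rotate_by_Qz rotate_by_Qy vec_eq_iff forall_3)

text \<open>Two nested polar decompositions: \<open>?z\<close> is the horizontal part of the
  tangent, and \<open>?y\<close> pairs its modulus with the vertical part. For a vertical tangent
  \<open>cmod ?z = 0\<close>, so the default azimuth has no effect.\<close>

lemma rotate_by_path_frame_axis1:
  "rotate_by (path_frame \<tau>) (vector [norm \<tau>, 0, 0]) = \<tau>"
proof -
  let ?z = "Complex (\<tau> $ 1) (\<tau> $ 2)"
  let ?y = "Complex (cmod ?z) (- (\<tau> $ 3))"
  have y: "cmod ?y = norm \<tau>"
    by (simp add: complex_norm norm_eq_sqrt_inner[where 'a = "real ^ 3"] inner_vec_def sum_3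
        power2_eq_square)
  have swap: "n * (x * c) = m * x" if "n * c = m" for n x c m :: real
    using that by auto
  have "norm \<tau> * cos (Arg ?y) = cmod ?z" "norm \<tau> * sin (Arg ?y) = - (\<tau> $ 3)"
    using cmod_times_cos_Arg[of ?y] cmod_times_sin_Arg[of ?y] unfolding y by simp_all
  moreover from this(1) have "norm \<tau> * (cos (Arg ?z) * cos (Arg ?y)) = \<tau> $ 1"
    "norm \<tau> * (sin (Arg ?z) * cos (Arg ?y)) = \<tau> $ 2"
    using cmod_times_cos_Arg[of ?z] cmod_times_sin_Arg[of ?z] by (simp_all add: swap)
  ultimately show ?thesis
    unfolding path_frame_def rotate_by_frame_axis1 path_azimuth_def path_elevation_def
    by (simp add: vec_eq_iff forall_3 complex_norm)
qed

section \<open>Line-of-sight direction and guidance field\<close>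

text \<open>This is the first axis rotated by \<open>qmul (Qz chi_r) (Qy nu_r)\<close>: the desired
  direction of motion in path coordinates.\<close>

definition line_of_sight :: "real \<Rightarrow> real \<Rightarrow> real ^ 3 \<Rightarrow> real ^ 3" where
  "line_of_sight \<mu> \<Delta>e \<epsilon> =
     vector [cos (chi_r \<Delta>e \<epsilon>) * cos (nu_r \<mu> \<Delta>e \<epsilon>), sin (chi_r \<Delta>e \<epsilon>) * cos (nu_r \<mu> \<Delta>e \<epsilon>),
             - sin (nu_r \<mu> \<Delta>e \<epsilon>)]"

lemma norm_line_of_sight: "norm (line_of_sight \<mu> \<Delta>e \<epsilon>) = 1"
proof -
  have "norm (vector [1, 0, 0] :: real ^ 3) = 1"
    by (simp add: norm_eq_sqrt_inner inner_vec_def sum_3)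
  then have "norm (rotate_by (qmul (Qz (chi_r \<Delta>e \<epsilon>)) (Qy (nu_r \<mu> \<Delta>e \<epsilon>))) (vector [1, 0, 0])) = 1"
    by (simp add: rotate_by_norm qmul_norm norm_Qz norm_Qy)
  then show ?thesis
    by (simp add: line_of_sight_def rotate_by_frame_axis1)
qed

text \<open>The angles \<open>\<chi>\<^sub>d\<close> and \<open>\<nu>\<^sub>d\<close> are spherical coordinates of the line-of-sight direction, rotated by
  the path frame. When this direction is vertical, \<open>\<chi>\<^sub>d\<close> is the junk value \<open>Arg 0\<close>, which does no
  harm because \<open>cos \<nu>\<^sub>d = 0\<close>.\<close>

lemma desired_velocity_eq:
  "desired_velocity U \<mu> \<Delta>e \<tau> \<epsilon> = U *\<^sub>R rotate_by (path_frame \<tau>) (line_of_sight \<mu> \<Delta>e \<epsilon>)"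
proof -
  define v where "v = rotate_by (path_frame \<tau>) (line_of_sight \<mu> \<Delta>e \<epsilon>)"
  have v: "norm v = 1"
    by (simp add: v_def rotate_by_norm path_frame_norm norm_line_of_sight)
  have chi: "chi_d \<mu> \<Delta>e \<tau> \<epsilon> = Arg (Complex (v $ 1) (v $ 2))"
    unfolding v_def path_frame_def rotate_by_qmul rotate_by_Qz rotate_by_Qy line_of_sight_def
      chi_d_def Let_def
    by (rule arg_cong[where f = Arg]) (simp add: complex_eq_iff algebra_simps)
  have "nu_d \<mu> \<Delta>e \<tau> \<epsilon> = arcsin (- (v $ 3))"
    unfolding v_def path_frame_def rotate_by_qmul rotate_by_Qz rotate_by_Qy line_of_sight_def
      nu_d_def Let_def
    by (rule arg_cong[where f = arcsin]) (simp add: algebra_simps)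
  moreover have "\<bar>v $ 3\<bar> \<le> 1"
    using component_le_norm_cart[of v 3] v by simp
  ultimately have nu: "sin (nu_d \<mu> \<Delta>e \<tau> \<epsilon>) = - (v $ 3)"
    "cos (nu_d \<mu> \<Delta>e \<tau> \<epsilon>) = sqrt (1 - (v $ 3)\<^sup>2)"
    by (simp_all add: cos_arcsin)
  have "(v $ 1)\<^sup>2 + (v $ 2)\<^sup>2 + (v $ 3)\<^sup>2 = 1"
    using v by (simp add: norm_eq_sqrt_inner inner_vec_def sum_3 power2_eq_square)
  then have "1 - (v $ 3)\<^sup>2 = (v $ 1)\<^sup>2 + (v $ 2)\<^sup>2" by linarith
  \<comment> \<open>Since \<open>arcsin\<close> takes values where the cosine is nonnegative, this
    cosine is exactly the modulus that belongs to the angle \<open>chi_d\<close>.\<close>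
  then have "cos (nu_d \<mu> \<Delta>e \<tau> \<epsilon>) = cmod (Complex (v $ 1) (v $ 2))"
    by (simp add: nu complex_norm)
  then have "cos (nu_d \<mu> \<Delta>e \<tau> \<epsilon>) * cos (chi_d \<mu> \<Delta>e \<tau> \<epsilon>) = v $ 1"
    "cos (nu_d \<mu> \<Delta>e \<tau> \<epsilon>) * sin (chi_d \<mu> \<Delta>e \<tau> \<epsilon>) = v $ 2"
    by (simp_all add: chi cmod_times_cos_Arg cmod_times_sin_Arg)
  then show ?thesis
    unfolding desired_velocity_def rotate_by_frame_axis1 v_def[symmetric]
    by (simp add: nu vec_eq_iff forall_3 mult.commute)
qed

text \<open>With \<open>r\<close> the root in \<open>Delta_h\<close>, the sine of
  \<open>chi_r\<close> is \<open>- e / r\<close> and the cosine of \<open>nu_r\<close> is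
  \<open>\<mu> * r / D\<close>, so \<open>r\<close> cancels. The choice of \<open>Delta_h\<close>
  thus gives both transverse errors the common denominator \<open>D\<close>.\<close>

lemma line_of_sight_transverse:
  fixes \<epsilon> :: "real ^ 3"
  assumes "0 < \<mu>" "0 < \<Delta>e"
  defines "D \<equiv> sqrt (\<mu>\<^sup>2 * (\<Delta>e\<^sup>2 + (\<epsilon> $ 2)\<^sup>2) + (\<epsilon> $ 3)\<^sup>2)"
  shows "line_of_sight \<mu> \<Delta>e \<epsilon> $ 2 = - (\<mu> * \<epsilon> $ 2 / D)" "line_of_sight \<mu> \<Delta>e \<epsilon> $ 3 = - (\<epsilon> $ 3 / D)"
proof -
  define r where "r = sqrt (\<Delta>e\<^sup>2 + (\<epsilon> $ 2)\<^sup>2)"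
  have r: "0 < r" "r\<^sup>2 = \<Delta>e\<^sup>2 + (\<epsilon> $ 2)\<^sup>2"
    using assms by (auto simp: r_def add_pos_nonneg)
  have root: "sqrt (1 + (x / y)\<^sup>2) = sqrt (y\<^sup>2 + x\<^sup>2) / y" if "0 < y" for x y :: real
  proof -
    have "1 + (x / y)\<^sup>2 = (y\<^sup>2 + x\<^sup>2) / y\<^sup>2" using that by (simp add: field_simps)
    then show ?thesis using that by (simp add: real_sqrt_divide)
  qed
  have D: "D = sqrt ((\<mu> * r)\<^sup>2 + (\<epsilon> $ 3)\<^sup>2)" by (simp add: D_def power_mult_distrib r)
  have chi: "sin (chi_r \<Delta>e \<epsilon>) = - (\<epsilon> $ 2 / r)"
    using assms r by (simp add: chi_r_def sin_arctan root r_def)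
  have mr: "0 < \<mu> * r" using assms r by simp
  have nu: "sin (nu_r \<mu> \<Delta>e \<epsilon>) = \<epsilon> $ 3 / D" "cos (nu_r \<mu> \<Delta>e \<epsilon>) = \<mu> * r / D"
    using order.strict_implies_not_eq[OF mr]
    unfolding nu_r_def Delta_h_def r_def[symmetric] sin_arctan cos_arctan root[OF mr] D
    by (simp_all add: divide_simps)
  show "line_of_sight \<mu> \<Delta>e \<epsilon> $ 2 = - (\<mu> * \<epsilon> $ 2 / D)" "line_of_sight \<mu> \<Delta>e \<epsilon> $ 3 = - (\<epsilon> $ 3 / D)"
    using r(1) mr by (simp_all add: line_of_sight_def chi nu)
qed

text \<open>On the ball, \<open>D\<close> lies between \<open>\<mu> * \<Delta>e\<close> and
  \<open>M\<close>, so the transverse gain \<open>U / D\<close> lies between \<open>a / M\<close>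
  and \<open>b / (\<mu> * \<Delta>e)\<close>. The field is diagonal with these gains:
  \<open>k\<close> bounds all three from below, and \<open>C\<close> adds their upper
  bounds.\<close>

lemma guidance_field_bounds:
  assumes params: "0 < \<gamma>" "0 < \<mu>" "0 < \<Delta>e" and a: "0 < a"
  obtains k C where "0 < k"
    and "\<And>U \<epsilon>. a \<le> U \<Longrightarrow> U \<le> b \<Longrightarrow> norm \<epsilon> \<le> R \<Longrightarrow>
      \<epsilon> \<bullet> vector [- \<gamma> * \<epsilon> $ 1, U * line_of_sight \<mu> \<Delta>e \<epsilon> $ 2, U * line_of_sight \<mu> \<Delta>e \<epsilon> $ 3]
        \<le> - k * (norm \<epsilon>)\<^sup>2"
    and "\<And>U \<epsilon>. a \<le> U \<Longrightarrow> U \<le> b \<Longrightarrow> norm \<epsilon> \<le> R \<Longrightarrow>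
      norm (vector [- \<gamma> * \<epsilon> $ 1, U * line_of_sight \<mu> \<Delta>e \<epsilon> $ 2, U * line_of_sight \<mu> \<Delta>e \<epsilon> $ 3] :: real ^ 3)
        \<le> C * norm \<epsilon>"
proof -
  define M where "M = sqrt (\<mu>\<^sup>2 * (\<Delta>e\<^sup>2 + R\<^sup>2) + R\<^sup>2)"
  define D where "D = (\<lambda>\<epsilon> :: real ^ 3. sqrt (\<mu>\<^sup>2 * (\<Delta>e\<^sup>2 + (\<epsilon> $ 2)\<^sup>2) + (\<epsilon> $ 3)\<^sup>2))"
  define k where "k = min \<gamma> (a / M * min \<mu> 1)"
  define C where "C = \<gamma> + b * \<mu> / (\<mu> * \<Delta>e) + b / (\<mu> * \<Delta>e)"
  have "0 < M" using params by (auto simp: M_def intro!: add_pos_nonneg mult_pos_pos)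
  then have k: "0 < k" using params a by (simp add: k_def)
  have D_low: "\<mu> * \<Delta>e \<le> D \<epsilon>" for \<epsilon>
    unfolding D_def by (rule real_le_rsqrt) (simp add: algebra_simps)
  have D_up: "D \<epsilon> \<le> M" if "norm \<epsilon> \<le> R" for \<epsilon>
  proof -
    have "(\<epsilon> $ i)\<^sup>2 \<le> R\<^sup>2" for i
      using component_le_norm_cart[of \<epsilon> i] that by (simp add: abs_le_square_iff[symmetric])
    then show ?thesis
      unfolding D_def M_def by (intro real_sqrt_le_mono add_mono mult_left_mono) auto
  qed
  have \<mu>\<Delta>: "0 < \<mu> * \<Delta>e" using params by simp
  have los: "line_of_sight \<mu> \<Delta>e \<epsilon> $ 2 = - (\<mu> * \<epsilon> $ 2 / D \<epsilon>)"
    "line_of_sight \<mu> \<Delta>e \<epsilon> $ 3 = - (\<epsilon> $ 3 / D \<epsilon>)" for \<epsilon>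
    using line_of_sight_transverse[OF params(2,3)] by (simp_all add: D_def)
  have 1: "\<epsilon> \<bullet> vector [- \<gamma> * \<epsilon> $ 1, U * line_of_sight \<mu> \<Delta>e \<epsilon> $ 2, U * line_of_sight \<mu> \<Delta>e \<epsilon> $ 3]
      \<le> - k * (norm \<epsilon>)\<^sup>2" if "a \<le> U" "norm \<epsilon> \<le> R" for U \<epsilon>
  proof -
    have q: "a / M \<le> U / D \<epsilon>"
      using that a D_low[of \<epsilon>] \<mu>\<Delta> D_up[of \<epsilon>] by (intro frac_le) auto
    have "k \<le> U / D \<epsilon> * \<mu>" "k \<le> U / D \<epsilon> * 1"
    proof -
      have "0 \<le> U / D \<epsilon>" using q a \<open>0 < M\<close> order_trans[OF _ q, of 0] by simp
      then have "a / M * min \<mu> 1 \<le> U / D \<epsilon> * \<mu>" "a / M * min \<mu> 1 \<le> U / D \<epsilon> * 1"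
        using q params by (intro mult_mono; simp)+
      then show "k \<le> U / D \<epsilon> * \<mu>" "k \<le> U / D \<epsilon> * 1" by (auto simp: k_def)
    qed
    then have "k * (\<epsilon> $ 2)\<^sup>2 \<le> U / D \<epsilon> * \<mu> * (\<epsilon> $ 2)\<^sup>2" "k * (\<epsilon> $ 3)\<^sup>2 \<le> U / D \<epsilon> * 1 * (\<epsilon> $ 3)\<^sup>2"
      by (intro mult_right_mono; simp)+
    moreover have "k * (\<epsilon> $ 1)\<^sup>2 \<le> \<gamma> * (\<epsilon> $ 1)\<^sup>2"
      by (intro mult_right_mono) (auto simp: k_def)
    ultimately show ?thesis
      unfolding los power2_norm_eq_inner by (simp add: inner_vec_def sum_3 power2_eq_square algebra_simps)
  qed
  have 2: "norm (vector [- \<gamma> * \<epsilon> $ 1, U * line_of_sight \<mu> \<Delta>e \<epsilon> $ 2, U * line_of_sight \<mu> \<Delta>e \<epsilon> $ 3] :: real ^ 3)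
      \<le> C * norm \<epsilon>" (is "norm ?g \<le> _") if "a \<le> U" "U \<le> b" for U \<epsilon>
  proof -
    have q: "U / D \<epsilon> \<le> b / (\<mu> * \<Delta>e)" "0 \<le> U / D \<epsilon>"
      using that a D_low[of \<epsilon>] \<mu>\<Delta> by (auto intro!: frac_le)
    have "norm ?g \<le> \<bar>?g $ 1\<bar> + \<bar>?g $ 2\<bar> + \<bar>?g $ 3\<bar>"
      using norm_le_l1_cart[of ?g] by (simp add: sum_3)
    also have "\<dots> = \<gamma> * \<bar>\<epsilon> $ 1\<bar> + U / D \<epsilon> * \<mu> * \<bar>\<epsilon> $ 2\<bar> + U / D \<epsilon> * \<bar>\<epsilon> $ 3\<bar>"
      using params that a abs_of_pos[OF less_le_trans[OF \<mu>\<Delta> D_low[of \<epsilon>]]]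
      unfolding los by (simp add: abs_mult)
    also have "\<dots> \<le> \<gamma> * norm \<epsilon> + b / (\<mu> * \<Delta>e) * \<mu> * norm \<epsilon> + b / (\<mu> * \<Delta>e) * norm \<epsilon>"
      using params q that a
      by (intro add_mono mult_mono component_le_norm_cart) auto
    also have "\<dots> = C * norm \<epsilon>" by (simp add: C_def algebra_simps)
    finally show ?thesis .
  qed
  show ?thesis using that[OF k] 1 2 by blast
qed

section \<open>Closed loop of vehicle, path parameter and observer\<close>

theorem theorem1:
  fixes N :: nat and knot :: "nat \<Rightarrow> real" and p d :: "nat \<Rightarrow> real ^ 3" and w :: "real ^ 3"
    and \<eta>p \<eta>p' :: "real \<Rightarrow> real ^ 3" and I :: "real set"
    and \<gamma> \<mu> \<Delta>e kc :: real
    and c :: "real ^ 3"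
    and Ud u :: "real \<Rightarrow> real"
    and \<eta> chat \<epsilon> :: "real \<Rightarrow> real ^ 3"
  assumes spline: "ph_quintic_spline N knot p d w \<eta>p \<eta>p'"
    and continuation: "{knot 0..knot N} \<subseteq> I" "regular_C1_path I \<eta>p \<eta>p'"
    and params: "0 < \<gamma>" "0 < \<mu>" "0 < \<Delta>e" "0 < kc"
    and parameter_in_domain: "\<And>t. 0 \<le> t \<Longrightarrow> u t \<in> I"
    and error: "\<And>t. \<epsilon> t = track_error (\<eta>p' (u t)) (\<eta> t - \<eta>p (u t))"
    and speed: "admissible_speed Ud \<epsilon>"
    and vehicle: "\<And>t. 0 \<le> t \<Longrightarrow>
      (\<eta> has_vector_derivative desired_velocity (Ud t) \<mu> \<Delta>e (\<eta>p' (u t)) (\<epsilon> t) - chat t + c)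
        (at t within {0..})"
    and parameter: "\<And>t. 0 \<le> t \<Longrightarrow>
      (u has_real_derivative parameter_rate (Ud t) \<gamma> \<mu> \<Delta>e (\<eta>p' (u t)) (\<epsilon> t)) (at t within {0..})"
    and observer: "\<And>t. 0 \<le> t \<Longrightarrow>
      (chat has_vector_derivative kc *\<^sub>R (\<eta> t - \<eta>p (u t))) (at t within {0..})"
  shows "((\<lambda>t. norm (c - chat t)) \<longlongrightarrow> 0) at_top \<and> ((\<lambda>t. norm (\<epsilon> t)) \<longlongrightarrow> 0) at_top"
proof -
  define F where "F = (\<lambda>t. path_frame (\<eta>p' (u t)))"
  define \<xi> where "\<xi> = (\<lambda>t. \<eta> t - \<eta>p (u t))"
  \<comment> \<open>The field \<open>g\<close> of the error equation in path coordinates;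
    \<open>F t\<close> carries it back to fixed coordinates, in which \<open>\<xi>\<close> is
    differentiated.\<close>
  define G :: "real \<Rightarrow> real ^ 3" where "G = (\<lambda>t. vector [- \<gamma> * \<epsilon> t $ 1,
    Ud t * line_of_sight \<mu> \<Delta>e (\<epsilon> t) $ 2, Ud t * line_of_sight \<mu> \<Delta>e (\<epsilon> t) $ 3])"
  have norm_\<epsilon>: "norm (\<epsilon> t) = norm (\<xi> t)" for t
    by (simp add: error track_error_norm \<xi>_def)
  have "(\<xi> has_vector_derivative rotate_by (F t) (G t) + (c - chat t)) (at t within {0..})"
    if t: "0 \<le> t" for t
  proof -
    let ?\<tau> = "\<eta>p' (u t)" and ?l = "line_of_sight \<mu> \<Delta>e (\<epsilon> t)"
    let ?r = "parameter_rate (Ud t) \<gamma> \<mu> \<Delta>e ?\<tau> (\<epsilon> t)"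
    \<comment> \<open>The chain rule asks for the derivative only within the range of
      \<open>u\<close>, a subset of \<open>I\<close>, so one-sided derivatives at end points of
      \<open>I\<close> suffice.\<close>
    have "(\<eta>p has_vector_derivative ?\<tau>) (at (u t) within u ` {0..})"
      using continuation(2) parameter_in_domain t unfolding regular_C1_path_def
      by (auto intro: has_vector_derivative_within_subset)
    from vector_diff_chain_within[OF parameter[OF t, unfolded has_real_derivative_iff_has_vector_derivative] this]
    have path: "((\<lambda>t. \<eta>p (u t)) has_vector_derivative ?r *\<^sub>R ?\<tau>) (at t within {0..})"
      by (simp add: o_def)
    have "?\<tau> \<noteq> 0"
      using continuation(2) parameter_in_domain[OF t] by (simp add: regular_C1_path_def)
    then have "?r * norm ?\<tau> = Ud t * ?l $ 1 + \<gamma> * \<epsilon> t $ 1"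
      by (simp add: parameter_rate_def line_of_sight_def)
    \<comment> \<open>The transverse components of \<open>Ud t *\<^sub>R ?l\<close> and
      \<open>G t\<close> agree; along the track their difference is the speed of the path point, by
      the parameter law.\<close>
    then have r: "?r *\<^sub>R vector [norm ?\<tau>, 0, 0] = (Ud t *\<^sub>R ?l - G t :: real ^ 3)"
      by (simp add: G_def vec_eq_iff forall_3)
    have "?r *\<^sub>R ?\<tau> = rotate_by (F t) (?r *\<^sub>R vector [norm ?\<tau>, 0, 0])"
      by (simp add: F_def linear_scale[OF rotate_by_linear] rotate_by_path_frame_axis1)
    also have "\<dots> = Ud t *\<^sub>R rotate_by (F t) ?l - rotate_by (F t) (G t)"
      unfolding r by (simp add: linear_diff[OF rotate_by_linear] linear_scale[OF rotate_by_linear])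
    finally have rate: "?r *\<^sub>R ?\<tau> = Ud t *\<^sub>R rotate_by (F t) ?l - rotate_by (F t) (G t)" .
    \<comment> \<open>The desired velocity cancels against its copy in \<open>rate\<close>, leaving
      the rotated \<open>G t\<close> and the estimation error.\<close>
    show ?thesis
      using has_vector_derivative_diff[OF vehicle[OF t] path]
      unfolding rate desired_velocity_eq \<xi>_def F_def by (simp add: algebra_simps)
  qed
  moreover have "((\<lambda>t. c - chat t) has_vector_derivative - kc *\<^sub>R \<xi> t) (at t within {0..})"
    if "0 \<le> t" for t
    using has_vector_derivative_diff[OF has_vector_derivative_const observer[OF that]]
    by (simp add: \<xi>_def)
  moreover have "\<exists>k>0. \<exists>C. \<forall>t\<ge>0. norm (\<xi> t) \<le> R \<longrightarrow>
      \<xi> t \<bullet> rotate_by (F t) (G t) \<le> - k * (norm (\<xi> t))\<^sup>2 \<and>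
      norm (rotate_by (F t) (G t)) \<le> C * norm (\<xi> t)" for R
  proof -
    obtain a b where "0 < a" and ab: "\<And>t. 0 \<le> t \<Longrightarrow> norm (\<epsilon> t) \<le> R \<Longrightarrow> a \<le> Ud t \<and> Ud t \<le> b"
      using speed unfolding admissible_speed_def by metis
    obtain k C where k: "0 < k" and kC: "\<And>t. 0 \<le> t \<Longrightarrow> norm (\<epsilon> t) \<le> R \<Longrightarrow>
        \<epsilon> t \<bullet> G t \<le> - k * (norm (\<epsilon> t))\<^sup>2 \<and> norm (G t) \<le> C * norm (\<epsilon> t)"
      using guidance_field_bounds[OF params(1-3) \<open>0 < a\<close>] ab unfolding G_def by metis
    \<comment> \<open>By adjointness the bounds found in path coordinates transfer, at each time
      separately, to fixed coordinates.\<close>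
    have "\<xi> t \<bullet> rotate_by (F t) (G t) = \<epsilon> t \<bullet> G t" for t
      by (simp add: error track_error_def \<xi>_def F_def inner_rotate_by_qconj)
    moreover have "norm (rotate_by (F t) (G t)) = norm (G t)" for t
      by (simp add: rotate_by_norm F_def path_frame_norm)
    ultimately show ?thesis using k kC unfolding norm_\<epsilon> by metis
  qed
  ultimately show ?thesis
    using observer_error_convergence[OF params(4), of \<xi> "\<lambda>t. rotate_by (F t) (G t)" "\<lambda>t. c - chat t"]
    unfolding norm_\<epsilon> by blast
qed

end
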